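(* Let $A \in \mathbb{R}^{m\times n}$ and let $L \in \mathbb{R}^{p\times n}$ ($p\ge n$) be column orthogonal, i.e. $L^\top L = I_n$. Let $k = \operatorname{rank}(A)$, $\tilde m = \min\{m,n\}$, and let $A = U_A \Sigma V_A^\top$ be a singular value decomposition of $A$ with singular values $\sigma_1 \ge \sigma_2 \ge \dots \ge \sigma_{\tilde m} \ge 0$. Then the generalized singular values $\gamma_1 \ge \gamma_2 \ge \dots \ge \gamma_n$ in the generalized singular value decomposition (GSVD) of $\{A,L\}$ satisfy $\gamma_i = \sigma_i$ for $i = 1,\dots,\tilde m$ and $\gamma_i = 0$ for $i = \tilde m+1,\dots,n$. Further, $Y = V_A G$, where $$G = \operatorname{diag}\left(\frac{1}{\sqrt{\sigma_1^2+1}},\dots,\frac{1}{\sqrt{\sigma_k^2+1}},1,\dots,1\right)\in\mathbb{R}^{n\times n}$$ (with $n-k$ trailing ones); that is, there is a GSVD $A = U\tilde\Upsilon Y^{-1}$, $L = V\tilde M Y^{-1}$ of $\{A,L\}$ whose factor $Y$ equals $V_A G$.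
   Context: SVD: $A = U_A\Sigma V_A^\top$ with $U_A\in\mathbb{R}^{m\times m}$ and $V_A\in\mathbb{R}^{n\times n}$ orthogonal and $\Sigma\in\mathbb{R}^{m\times n}$ diagonal with diagonal entries $\sigma_1\ge\dots\ge\sigma_{\tilde m}\ge 0$. GSVD of a pair $\{A,L\}$, $A\in\mathbb{R}^{m\times n}$, $L\in\mathbb{R}^{p\times n}$: let $K = \begin{bmatrix}A\\L\end{bmatrix}$, $t=\operatorname{rank}(K)$, $r=\operatorname{rank}(K)-\operatorname{rank}(L)$, $s=\operatorname{rank}(A)+\operatorname{rank}(L)-\operatorname{rank}(K)$. A GSVD consists of orthogonal matrices $U\in\mathbb{R}^{m\times m}$, $V\in\mathbb{R}^{p\times p}$, $W\in\mathbb{R}^{t\times t}$, $Q\in\mathbb{R}^{n\times n}$ and a nonsingular $R\in\mathbb{R}^{t\times t}$, whose singular values are the nonzero singular values of $K$, such that $$U^\top A Q = \tilde\Upsilon\,[W^\top R,\ 0_{t\times(n-t)}],\qquad V^\top L Q = \tilde M\,[W^\top R,\ 0_{t\times(n-t)}],$$ where $\tilde\Upsilon\in\mathbb{R}^{m\times t}$ and $\tilde M\in\mathbb{R}^{p\times t}$ are the block-diagonal matrices $$\tilde\Upsilon=\begin{bmatrix} I_A & & \\ & \Upsilon & \\ & & 0_A\end{bmatrix},\qquad \tilde M=\begin{bmatrix} 0_L & & \\ & M & \\ & & I_L\end{bmatrix},$$ with identity blocks $I_A\in\mathbb{R}^{r\times r}$, $I_L\in\mathbb{R}^{(t-r-s)\times(t-r-s)}$,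 zero blocks $0_A\in\mathbb{R}^{(m-r-s)\times(t-r-s)}$, $0_L\in\mathbb{R}^{(p-t+r)\times r}$ (blocks may be empty in one or both dimensions), $\Upsilon=\operatorname{diag}(\upsilon_{r+1},\dots,\upsilon_{r+s})$ with $1>\upsilon_{r+1}\ge\dots\ge\upsilon_{r+s}>0$, $M=\operatorname{diag}(\mu_{r+1},\dots,\mu_{r+s})$ with $0<\mu_{r+1}\le\dots\le\mu_{r+s}<1$, and $\upsilon_i^2+\mu_i^2=1$ for $r+1\le i\le r+s$. Set $\upsilon_i=1,\mu_i=0$ for $i<r+1$, and $\upsilon_i=0,\mu_i=1$ for $r+s<i\le t$. The generalized singular values are $\gamma_i=\upsilon_i/\mu_i$, $i=1,\dots,t$ (infinite if $\mu_i=0$), listed in decreasing order. With $Z = Q\begin{bmatrix}R^\top W\\ 0_{(n-t)\times t}\end{bmatrix}\in\mathbb{R}^{n\times t}$ one has $A=U\tilde\Upsilon Z^\top$, $L=V\tilde M Z^\top$. When $t=n$ (which holds automatically if $L$ is column orthogonal), $Z$ is invertible and $Y$ is defined by $Y^{-1}=Z^\top$, so $A=U\tilde\Upsilon Y^{-1}$ and $L=V\tilde M Y^{-1}$. *)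

theory Defs
  imports "Jordan_Normal_Form.DL_Rank" "HOL-Library.Extended_Real"
begin

(* All indices start at 0: sigma i, upsilon i, mu i stand for the customary
   sigma_(i+1), upsilon_(i+1), mu_(i+1). *)

definition mat_rank :: "real mat \<Rightarrow> nat" where
  "mat_rank A = vec_space.rank (dim_row A) A"

(* The library's orthogonal_mat only asks for pairwise orthogonal nonzero columns,
   not for unit columns. *)
definition is_orthogonal :: "nat \<Rightarrow> real mat \<Rightarrow> bool" where
  "is_orthogonal n Q \<longleftrightarrow> Q \<in> carrier_mat n n \<and> Q\<^sup>T * Q = 1\<^sub>m n \<and> Q * Q\<^sup>T = 1\<^sub>m n"

definition rect_diag :: "nat \<Rightarrow> nat \<Rightarrow> (nat \<Rightarrow> real) \<Rightarrow> real mat" where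
  "rect_diag m n \<sigma> = mat m n (\<lambda>(i, j). if i = j then \<sigma> i else 0)"

(* Only the values of sigma below min m n matter. *)
definition is_svd :: "nat \<Rightarrow> nat \<Rightarrow> real mat \<Rightarrow> real mat \<Rightarrow> (nat \<Rightarrow> real) \<Rightarrow> real mat \<Rightarrow> bool" where
  "is_svd m n A U \<sigma> V \<longleftrightarrow>
     A \<in> carrier_mat m n \<and> is_orthogonal m U \<and> is_orthogonal n V \<and>
     (\<forall>i < min m n. 0 \<le> \<sigma> i) \<and>
     (\<forall>i j. i \<le> j \<and> j < min m n \<longrightarrow> \<sigma> j \<le> \<sigma> i) \<and>
     A = U * rect_diag m n \<sigma> * V\<^sup>T"

(* The list contains all min m n singular values in decreasing order, zeros included. *)
definition has_singular_values :: "real mat \<Rightarrow> real list \<Rightarrow> bool" where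
  "has_singular_values A xs \<longleftrightarrow>
     (\<exists>U \<sigma> V. is_svd (dim_row A) (dim_col A) A U \<sigma> V \<and>
              xs = map \<sigma> [0..<min (dim_row A) (dim_col A)])"

definition gsvd_t :: "real mat \<Rightarrow> real mat \<Rightarrow> nat" where
  "gsvd_t A L = mat_rank (A @\<^sub>r L)"

definition gsvd_r :: "real mat \<Rightarrow> real mat \<Rightarrow> nat" where
  "gsvd_r A L = mat_rank (A @\<^sub>r L) - mat_rank L"

definition gsvd_s :: "real mat \<Rightarrow> real mat \<Rightarrow> nat" where
  "gsvd_s A L = mat_rank A + mat_rank L - mat_rank (A @\<^sub>r L)"

(* diag_block_mat also handles blocks that are empty in one or both dimensions; for t, r, s
   as above none of the subtractions truncates. *)
definition gsvd_Upsilon :: "nat \<Rightarrow> nat \<Rightarrow> nat \<Rightarrow> nat \<Rightarrow> (nat \<Rightarrow> real) \<Rightarrow> real mat" where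
  "gsvd_Upsilon m t r s \<upsilon> =
     diag_block_mat [1\<^sub>m r, mat_diag s (\<lambda>i. \<upsilon> (r + i)), 0\<^sub>m (m - r - s) (t - r - s)]"

definition gsvd_M :: "nat \<Rightarrow> nat \<Rightarrow> nat \<Rightarrow> nat \<Rightarrow> (nat \<Rightarrow> real) \<Rightarrow> real mat" where
  "gsvd_M p t r s \<mu> =
     diag_block_mat [0\<^sub>m (p + r - t) r, mat_diag s (\<lambda>i. \<mu> (r + i)), 1\<^sub>m (t - r - s)]"

definition gsvd_Z :: "nat \<Rightarrow> nat \<Rightarrow> real mat \<Rightarrow> real mat \<Rightarrow> real mat \<Rightarrow> real mat" where
  "gsvd_Z n t W Q R = Q * ((R\<^sup>T * W) @\<^sub>r 0\<^sub>m (n - t) t)"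

(* The block row [X, 0] with X = W^T R is written as a four-block matrix whose lower blocks
   have no rows. *)
definition is_gsvd ::
  "nat \<Rightarrow> nat \<Rightarrow> nat \<Rightarrow> real mat \<Rightarrow> real mat \<Rightarrow> real mat \<Rightarrow> real mat \<Rightarrow> real mat \<Rightarrow> real mat \<Rightarrow> real mat
    \<Rightarrow> (nat \<Rightarrow> real) \<Rightarrow> (nat \<Rightarrow> real) \<Rightarrow> bool" where
  "is_gsvd m n p A L U V W Q R \<upsilon> \<mu> \<longleftrightarrow>
     (let t = gsvd_t A L; r = gsvd_r A L; s = gsvd_s A L;
          X = four_block_mat (W\<^sup>T * R) (0\<^sub>m t (n - t)) (0\<^sub>m 0 t) (0\<^sub>m 0 (n - t))
      in A \<in> carrier_mat m n \<and> L \<in> carrier_mat p n \<and>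
         is_orthogonal m U \<and> is_orthogonal p V \<and> is_orthogonal t W \<and> is_orthogonal n Q \<and>
         R \<in> carrier_mat t t \<and> invertible_mat R \<and>
         (\<exists>xs ys. has_singular_values R xs \<and> has_singular_values (A @\<^sub>r L) ys \<and>
                  xs = filter (\<lambda>x. x \<noteq> 0) ys) \<and>
         (\<forall>i < r. \<upsilon> i = 1 \<and> \<mu> i = 0) \<and>
         (\<forall>i. r \<le> i \<and> i < r + s \<longrightarrow>
              0 < \<upsilon> i \<and> \<upsilon> i < 1 \<and> 0 < \<mu> i \<and> \<mu> i < 1 \<and> (\<upsilon> i)\<^sup>2 + (\<mu> i)\<^sup>2 = 1) \<and>
         (\<forall>i j. r \<le> i \<and> i \<le> j \<and> j < r + s \<longrightarrow> \<upsilon> j \<le> \<upsilon> i \<and> \<mu> i \<le> \<mu> j) \<and>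
         (\<forall>i. r + s \<le> i \<and> i < t \<longrightarrow> \<upsilon> i = 0 \<and> \<mu> i = 1) \<and>
         U\<^sup>T * A * Q = gsvd_Upsilon m t r s \<upsilon> * X \<and>
         V\<^sup>T * L * Q = gsvd_M p t r s \<mu> * X)"

definition gen_singular_values :: "nat \<Rightarrow> (nat \<Rightarrow> real) \<Rightarrow> (nat \<Rightarrow> real) \<Rightarrow> ereal list" where
  "gen_singular_values t \<upsilon> \<mu> =
     map (\<lambda>i. if \<mu> i = 0 then \<infinity> else ereal (\<upsilon> i / \<mu> i)) [0..<t]"

(* Yi is the inverse of Y; the factor Y exists only when t = n. *)
definition is_gsvd_Y ::
  "nat \<Rightarrow> nat \<Rightarrow> real mat \<Rightarrow> real mat \<Rightarrow> real mat \<Rightarrow> real mat \<Rightarrow> real mat \<Rightarrow> bool" where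
  "is_gsvd_Y n t W Q R Y Yi \<longleftrightarrow>
     t = n \<and> Y \<in> carrier_mat n n \<and> Yi \<in> carrier_mat n n \<and>
     inverts_mat Y Yi \<and> inverts_mat Yi Y \<and> Yi = (gsvd_Z n t W Q R)\<^sup>T"

end

theory Submission
  imports Defs "Jordan_Normal_Form.Char_Poly"
begin

text \<open>
  A column-orthogonal \<open>L\<close> has full column rank, so in every GSVD of the pair \<open>{A, L}\<close> the square matrix
  \<open>X = W\<^sup>T * R\<close> has size \<open>n\<close>, no \<open>\<mu> i\<close> vanishes, and the equations read
  \<open>U\<^sup>T * A * Q = diag \<upsilon> * X\<close> and \<open>V\<^sup>T * L * Q = diag \<mu> * X\<close> up to zero rows and columns.

  \<^item> Taking Gram matrices in the second equation shows that \<open>P = diag \<mu> * X\<close> is orthogonal. The first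
    equation becomes \<open>A = U * diag (\<upsilon> / \<mu>) * (Q * P\<^sup>T)\<^sup>T\<close>, a singular value decomposition of \<open>A\<close>
    (\<open>svd_of_gsvd\<close>). Singular values are unique, because their squares are the eigenvalues of
    \<open>A\<^sup>T * A\<close> (\<open>singular_values_unique\<close>); so \<open>\<gamma> = \<upsilon> / \<mu>\<close> are the singular values of \<open>A\<close>, followed by zeros.

  \<^item> Conversely, write \<open>h i = sqrt ((\<sigma> i)\<^sup>2 + 1)\<close> with \<open>\<sigma> i\<close> read as zero from \<open>min m n\<close> on. Then
    \<open>A = U\<^sub>A * diag (\<sigma> / h) * (diag h * V\<^sub>A\<^sup>T)\<close>, and completing the orthonormal columns of \<open>L * V\<^sub>A\<close> to an
    orthogonal matrix \<open>V\<close> gives \<open>L = V * diag (1 / h) * (diag h * V\<^sub>A\<^sup>T)\<close> with the diagonal in the last \<open>n\<close>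
    rows (\<open>gsvd_from_svd\<close>). The common factor is \<open>Y\<^sup>-\<^sup>1 = diag h * V\<^sub>A\<^sup>T\<close>, so
    \<open>Y = V\<^sub>A * diag (1 / h)\<close>. The entries of \<open>diag h\<close> are the singular values of the stacked matrix
    \<open>A @\<^sub>r L\<close>, whose Gram matrix is \<open>A\<^sup>T * A + 1\<close> (\<open>svd_append_orthonormal\<close>), as the definition of a
    GSVD requires of \<open>R\<close>.

  Both directions rest on the completion of orthonormal columns to an orthogonal matrix
  (\<open>orthonormal_columns_completion\<close>) and the fact that the rank is the number of nonzero singular values
  (\<open>mat_rank_svd\<close>), which fixes the block sizes.
\<close>

section \<open>Orthogonal matrices and Gram matrices\<close>

lemma mult_mat_regroup:
  assumes "A \<in> carrier_mat a b" "B \<in> carrier_mat b c" "C \<in> carrier_mat c d" "D \<in> carrier_mat d e"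
  shows "A * B * (C * D) = A * (B * C) * (D :: 'a :: semiring_0 mat)"
  using assms by (simp add: assoc_mult_mat[of _ a b _ c _ e] assoc_mult_mat[of _ b c _ d _ e]
    assoc_mult_mat[of _ a b _ d _ e])

text \<open>A column-orthogonal left factor \<open>B\<close> disappears from the Gram matrix of \<open>B * C\<close>. Applied to
  the defining equation of a GSVD for \<open>L\<close>, this turns the column orthogonality of \<open>L\<close> into that
  of \<open>diag \<mu> * X\<close>.\<close>

lemma gram_mult:
  assumes "B \<in> carrier_mat a b" "C \<in> carrier_mat b c"
  shows "(B * C)\<^sup>T * (B * C) = C\<^sup>T * (B\<^sup>T * B) * (C :: 'a :: comm_semiring_0 mat)"
  using assms by (simp add: transpose_mult[of B a b C c] mult_mat_regroup[of "C\<^sup>T" c b "B\<^sup>T" a B b C c])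

lemma transpose_mat_diag [simp]: "(mat_diag n f)\<^sup>T = mat_diag n f"
  by (rule eq_matI) (auto simp: mat_diag_def)

lemma is_orthogonalI:
  assumes "Q \<in> carrier_mat n n" "Q\<^sup>T * Q = 1\<^sub>m n"
  shows "is_orthogonal n Q"
  using assms mat_mult_left_right_inverse[of "Q\<^sup>T" n Q] by (auto simp: is_orthogonal_def)

lemma is_orthogonalD:
  assumes "is_orthogonal n Q"
  shows "Q \<in> carrier_mat n n" "Q\<^sup>T * Q = 1\<^sub>m n" "Q * Q\<^sup>T = 1\<^sub>m n"
  using assms by (auto simp: is_orthogonal_def)

lemma is_orthogonal_one: "is_orthogonal n (1\<^sub>m n)"
  by (rule is_orthogonalI) auto

lemma orthogonal_cancel_left:
  assumes "is_orthogonal m U" "B \<in> carrier_mat m n"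
  shows "U\<^sup>T * (U * B) = B" "U * (U\<^sup>T * B) = B"
  using is_orthogonalD[OF assms(1)] assms(2)
  by (simp_all add: assoc_mult_mat[of _ m m _ m _ n, symmetric])

lemma orthogonal_cancel_right:
  assumes "is_orthogonal n V" "B \<in> carrier_mat m n"
  shows "B * V * V\<^sup>T = B" "B * V\<^sup>T * V = B"
  using is_orthogonalD[OF assms(1)] assms(2)
  by (simp_all add: assoc_mult_mat[of _ m n _ n _ n])

lemma is_orthogonal_mult:
  assumes "is_orthogonal n P" "is_orthogonal n Q"
  shows "is_orthogonal n (P * Q)"
proof (rule is_orthogonalI)
  note P = is_orthogonalD[OF assms(1)] and Q = is_orthogonalD[OF assms(2)]
  show "P * Q \<in> carrier_mat n n" using P Q by auto
  show "(P * Q)\<^sup>T * (P * Q) = 1\<^sub>m n"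
    using P Q orthogonal_cancel_left(1)[OF assms(1) Q(1)]
    by (simp add: transpose_mult[of _ n n] assoc_mult_mat[of _ n n _ n _ n])
qed

lemma is_orthogonal_transpose: "is_orthogonal n Q \<Longrightarrow> is_orthogonal n Q\<^sup>T"
  by (simp add: is_orthogonal_def)

section \<open>Completing orthonormal columns to an orthogonal matrix\<close>

text \<open>As long as some index \<open>l\<close> has no vector yet, the square matrix with the given vectors as its rows
  and zero rows elsewhere is singular. A normalised kernel vector is orthogonal to all the given
  vectors and can be put at index \<open>l\<close>. Indexing the family by an arbitrary subset \<open>J\<close> leaves the
  positions of the prescribed columns free: the singular value decomposition of the stacked matrix
  wants them first, the block \<open>gsvd_M\<close> wants them last.\<close>

lemma orthonormal_family_extension:
  fixes v :: "nat \<Rightarrow> real vec"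
  assumes "J \<subseteq> {..<p}"
    and "\<And>i. i \<in> J \<Longrightarrow> v i \<in> carrier_vec p"
    and "\<And>i j. i \<in> J \<Longrightarrow> j \<in> J \<Longrightarrow> v i \<bullet> v j = (if i = j then 1 else 0)"
  shows "\<exists>w. (\<forall>i\<in>J. w i = v i) \<and> (\<forall>i<p. w i \<in> carrier_vec p) \<and>
             (\<forall>i<p. \<forall>j<p. w i \<bullet> w j = (if i = j then 1 else 0))"
  using assms
proof (induction "card ({..<p} - J)" arbitrary: J v)
  case 0
  then have "J = {..<p}" by auto
  with 0 show ?case by (intro exI[of _ v]) auto
next
  case (Suc d)
  then have "{..<p} - J \<noteq> {}" by auto
  then obtain l where l: "l < p" "l \<notin> J" by auto
  define B where "B = mat p p (\<lambda>(i, j). if i \<in> J then v i $ j else 0)"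
  have B: "B \<in> carrier_mat p p" by (simp add: B_def)
  have row_B: "row B i = v i" if "i \<in> J" for i
  proof -
    have "i < p" "dim_vec (v i) = p" using that Suc.prems(1,2) by auto
    then show ?thesis using that by (intro eq_vecI) (auto simp: B_def)
  qed
  have "B\<^sup>T *\<^sub>v unit_vec p l = 0\<^sub>v p"
  proof (rule eq_vecI)
    fix i assume "i < dim_vec (0\<^sub>v p :: real vec)"
    then show "(B\<^sup>T *\<^sub>v unit_vec p l) $ i = 0\<^sub>v p $ i" using l by (simp add: B_def)
  qed (simp add: B_def)
  then have "det B\<^sup>T = 0"
    using B l unit_vec_nonzero[of l p] by (subst det_0_iff_vec_prod_zero_field[of _ p]) (auto intro!: exI[of _ "unit_vec p l"])
  then have "det B = 0" using det_transpose[OF B] by simp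
  then obtain x where x: "x \<in> carrier_vec p" "x \<noteq> 0\<^sub>v p" "B *\<^sub>v x = 0\<^sub>v p"
    using det_0_iff_vec_prod_zero_field[OF B] by auto
  have orth: "v i \<bullet> x = 0" if "i \<in> J" for i
  proof -
    have "i < p" using that Suc.prems(1) by auto
    then have "(B *\<^sub>v x) $ i = row B i \<bullet> x" using B by simp
    with x(3) \<open>i < p\<close> row_B[OF that] show ?thesis by simp
  qed
  have pos: "x \<bullet> x > 0"
    using x conjugate_square_greater_0_vec[OF x(1)] by simp
  define u where "u = (1 / sqrt (x \<bullet> x)) \<cdot>\<^sub>v x"
  have u: "u \<in> carrier_vec p" using x by (simp add: u_def)
  have uu: "u \<bullet> u = 1"
    using pos x(1) by (simp add: u_def)
  have vu: "v i \<bullet> u = 0" if "i \<in> J" for i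
    using orth[OF that] Suc.prems(2)[OF that] x(1) by (simp add: u_def)
  have uv: "u \<bullet> v i = 0" if "i \<in> J" for i
    using vu[OF that] comm_scalar_prod[OF u Suc.prems(2)[OF that]] by simp
  have "card ({..<p} - insert l J) = card (({..<p} - J) - {l})"
    by (rule arg_cong[where f = card]) blast
  then have "d = card ({..<p} - insert l J)"
    using Suc.hyps(2) l by simp
  moreover have "insert l J \<subseteq> {..<p}" using Suc.prems l by auto
  ultimately have "\<exists>w. (\<forall>i\<in>insert l J. w i = (v(l := u)) i) \<and> (\<forall>i<p. w i \<in> carrier_vec p) \<and>
             (\<forall>i<p. \<forall>j<p. w i \<bullet> w j = (if i = j then 1 else 0))"
  proof (rule Suc.hyps(1))
    show "(v(l := u)) i \<in> carrier_vec p" if "i \<in> insert l J" for i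
      using that u Suc.prems(2) by auto
    show "(v(l := u)) i \<bullet> (v(l := u)) j = (if i = j then 1 else 0)"
      if "i \<in> insert l J" "j \<in> insert l J" for i j
      using that l(2) uu vu uv Suc.prems(3)[of i j] by (cases "i = l"; cases "j = l") auto
  qed
  then obtain w where w: "\<forall>i\<in>insert l J. w i = (v(l := u)) i" "\<forall>i<p. w i \<in> carrier_vec p"
     "\<forall>i<p. \<forall>j<p. w i \<bullet> w j = (if i = j then 1 else 0)" by blast
  then show ?case using l by (intro exI[of _ w]) auto
qed

text \<open>Right multiplication by this matrix selects the columns \<open>f 0, \<dots>, f (n - 1)\<close>.\<close>

definition column_embedding :: "nat \<Rightarrow> nat \<Rightarrow> (nat \<Rightarrow> nat) \<Rightarrow> real mat" where
  "column_embedding p n f = mat p n (\<lambda>(i, j). if i = f j then 1 else 0)"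

lemma column_embedding_carrier [simp]: "column_embedding p n f \<in> carrier_mat p n"
  by (simp add: column_embedding_def)

lemma column_embedding_gram:
  assumes "inj_on f {..<n}" "f ` {..<n} \<subseteq> {..<p}"
  shows "(column_embedding p n f)\<^sup>T * column_embedding p n f = 1\<^sub>m n"
proof (rule eq_matI)
  fix i j assume "i < dim_row (1\<^sub>m n)" "j < dim_col (1\<^sub>m n)"
  then have ij: "i < n" "j < n" by auto
  then have "f i < p" "f j < p" using assms(2) by auto
  have "((column_embedding p n f)\<^sup>T * column_embedding p n f) $$ (i, j)
      = (\<Sum>l\<in>{0..<p}. (if l = f i then 1 else 0) * (if l = f j then 1 else 0))"
    using ij by (simp add: column_embedding_def scalar_prod_def)
  also have "\<dots> = (\<Sum>l\<in>{0..<p}. if l = f i then (if f i = f j then 1 else 0) else 0)"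
    by (rule sum.cong) auto
  also have "\<dots> = (if f i = f j then 1 else 0)" using \<open>f i < p\<close> by simp
  also have "\<dots> = 1\<^sub>m n $$ (i, j)" using ij inj_onD[OF assms(1), of i j] by auto
  finally show "((column_embedding p n f)\<^sup>T * column_embedding p n f) $$ (i, j) = 1\<^sub>m n $$ (i, j)" .
qed (auto simp: column_embedding_def)

lemma orthonormal_columns_completion:
  assumes C: "C \<in> carrier_mat p n" "C\<^sup>T * C = 1\<^sub>m n"
    and f: "inj_on f {..<n}" "f ` {..<n} \<subseteq> {..<p}"
  shows "\<exists>V. is_orthogonal p V \<and> C = V * column_embedding p n f"
proof -
  let ?g = "the_inv_into {..<n} f"
  have g: "?g (f j) = j" if "j < n" for j using that f(1) by (simp add: the_inv_into_f_f)
  have gram: "col C i \<bullet> col C j = (if i = j then 1 else 0)" if "i < n" "j < n" for i j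
  proof -
    have "(C\<^sup>T * C) $$ (i, j) = col C i \<bullet> col C j" using C(1) that by simp
    with C(2) that show ?thesis by simp
  qed
  have "\<exists>w. (\<forall>i\<in>f ` {..<n}. w i = (\<lambda>i. col C (?g i)) i) \<and> (\<forall>i<p. w i \<in> carrier_vec p) \<and>
             (\<forall>i<p. \<forall>j<p. w i \<bullet> w j = (if i = j then 1 else 0))"
    by (rule orthonormal_family_extension[OF f(2)]) (use C(1) g gram in auto)
  then obtain w where "\<forall>i\<in>f ` {..<n}. w i = col C (?g i)" "\<forall>i<p. w i \<in> carrier_vec p"
     "\<forall>i<p. \<forall>j<p. w i \<bullet> w j = (if i = j then 1 else 0)" by blast
  then have w: "\<And>j. j < n \<Longrightarrow> w (f j) = col C j" "\<And>i. i < p \<Longrightarrow> w i \<in> carrier_vec p"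
     "\<And>i j. i < p \<Longrightarrow> j < p \<Longrightarrow> w i \<bullet> w j = (if i = j then 1 else 0)" using g by auto
  define V where "V = mat p p (\<lambda>(i, j). w j $ i)"
  have V: "V \<in> carrier_mat p p" by (simp add: V_def)
  have col_V: "col V j = w j" if "j < p" for j
    using that w(2)[OF that] by (intro eq_vecI) (auto simp: V_def)
  have "is_orthogonal p V"
    by (rule is_orthogonalI[OF V], rule eq_matI) (use V col_V w(3) in auto)
  moreover have "C = V * column_embedding p n f"
  proof (rule eq_matI)
    fix i j assume "i < dim_row (V * column_embedding p n f)" "j < dim_col (V * column_embedding p n f)"
    then have ij: "i < p" "j < n" using V by (auto simp: column_embedding_def)
    then have "f j < p" using f(2) by auto
    have "(V * column_embedding p n f) $$ (i, j) = (\<Sum>l\<in>{0..<p}. V $$ (i, l) * (if l = f j then 1 else 0))"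
      using V ij by (simp add: column_embedding_def scalar_prod_def)
    also have "\<dots> = V $$ (i, f j)" using \<open>f j < p\<close> by (simp add: if_distrib cong: if_cong)
    also have "\<dots> = col C j $ i" using \<open>f j < p\<close> ij w(1) by (simp add: V_def)
    finally show "C $$ (i, j) = (V * column_embedding p n f) $$ (i, j)" using ij C(1) by simp
  qed (use C(1) V in \<open>auto simp: column_embedding_def\<close>)
  ultimately show ?thesis by blast
qed

section \<open>Singular value decompositions\<close>

text \<open>The values \<open>\<sigma> i\<close> of a singular value decomposition are unspecified for \<open>i \<ge> min m n\<close>, whereas the
  \<open>n\<close> eigenvalues of \<open>A\<^sup>T * A\<close> and the \<open>n\<close> generalized singular values continue with zeros.\<close>

definition zero_pad :: "nat \<Rightarrow> (nat \<Rightarrow> real) \<Rightarrow> nat \<Rightarrow> real" where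
  "zero_pad q \<sigma> i = (if i < q then \<sigma> i else 0)"

lemma rect_diag_carrier [simp]: "rect_diag m n \<sigma> \<in> carrier_mat m n"
  by (simp add: rect_diag_def)

lemma rect_diag_cong: "(\<And>i. i < min m n \<Longrightarrow> \<sigma> i = \<tau> i) \<Longrightarrow> rect_diag m n \<sigma> = rect_diag m n \<tau>"
  unfolding rect_diag_def by (intro cong_mat) auto

lemma rect_diag_mult_mat_diag:
  "rect_diag m n \<sigma> * mat_diag n g = rect_diag m n (\<lambda>i. \<sigma> i * g i)"
  by (subst mat_diag_mult_right[of _ m n]) (auto simp: rect_diag_def intro!: cong_mat)

lemma rect_diag_gram:
  "(rect_diag m n \<sigma>)\<^sup>T * rect_diag m n \<sigma> = mat_diag n (\<lambda>i. (zero_pad (min m n) \<sigma> i)\<^sup>2)"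
proof (rule eq_matI)
  fix i j assume "i < dim_row (mat_diag n (\<lambda>i. (zero_pad (min m n) \<sigma> i)\<^sup>2))"
    "j < dim_col (mat_diag n (\<lambda>i. (zero_pad (min m n) \<sigma> i)\<^sup>2))"
  then have ij: "i < n" "j < n" by (auto simp: mat_diag_def)
  have "((rect_diag m n \<sigma>)\<^sup>T * rect_diag m n \<sigma>) $$ (i, j)
      = (\<Sum>l\<in>{0..<m}. (if l = i then \<sigma> l else 0) * (if l = j then \<sigma> l else 0))"
    using ij by (simp add: rect_diag_def scalar_prod_def)
  also have "\<dots> = (\<Sum>l\<in>{0..<m}. if l = i then (if i = j then (\<sigma> i)\<^sup>2 else 0) else 0)"
    by (rule sum.cong) (auto simp: power2_eq_square)
  also have "\<dots> = mat_diag n (\<lambda>i. (zero_pad (min m n) \<sigma> i)\<^sup>2) $$ (i, j)"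
    using ij by (simp add: mat_diag_def zero_pad_def)
  finally show "((rect_diag m n \<sigma>)\<^sup>T * rect_diag m n \<sigma>) $$ (i, j)
      = mat_diag n (\<lambda>i. (zero_pad (min m n) \<sigma> i)\<^sup>2) $$ (i, j)" .
qed (auto simp: rect_diag_def mat_diag_def)

lemma is_svdD:
  assumes "is_svd m n A U \<sigma> V"
  shows "A \<in> carrier_mat m n" "is_orthogonal m U" "is_orthogonal n V"
    "U \<in> carrier_mat m m" "V \<in> carrier_mat n n"
    "\<And>i. i < min m n \<Longrightarrow> 0 \<le> \<sigma> i"
    "\<And>i j. i \<le> j \<Longrightarrow> j < min m n \<Longrightarrow> \<sigma> j \<le> \<sigma> i"
    "A = U * rect_diag m n \<sigma> * V\<^sup>T"
  using assms by (auto simp: is_svd_def is_orthogonal_def)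

lemma is_svd_zero_pad:
  assumes "is_svd m n A U \<sigma> V"
  shows "is_svd m n A U (zero_pad (min m n) \<sigma>) V"
  using assms rect_diag_cong[of m n \<sigma> "zero_pad (min m n) \<sigma>"]
  by (auto simp: is_svd_def zero_pad_def)

lemma svd_gram:
  assumes "is_svd m n A U \<sigma> V"
  shows "A\<^sup>T * A = V * mat_diag n (\<lambda>i. (zero_pad (min m n) \<sigma> i)\<^sup>2) * V\<^sup>T"
proof -
  note S = is_svdD[OF assms]
  let ?D = "rect_diag m n \<sigma>"
  have D: "?D \<in> carrier_mat m n" by simp
  have DV: "?D * V\<^sup>T \<in> carrier_mat m n" using S(5) by (intro mult_carrier_mat) auto
  have A: "A = U * (?D * V\<^sup>T)" using S(8) assoc_mult_mat[OF S(4) D, of "V\<^sup>T" n] S(5) by simp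
  have "A\<^sup>T = V * ?D\<^sup>T * U\<^sup>T"
    unfolding A using S(4,5) by (simp add: transpose_mult[OF S(4) DV] transpose_mult[OF D, of "V\<^sup>T" n])
  then have "A\<^sup>T * A = V * ?D\<^sup>T * (U\<^sup>T * (U * (?D * V\<^sup>T)))"
    using S(4,5) A assoc_mult_mat[of "V * ?D\<^sup>T" n m "U\<^sup>T" m A n] S(1) by simp
  also have "\<dots> = V * ?D\<^sup>T * (?D * V\<^sup>T)"
    using orthogonal_cancel_left[OF S(2) DV] by simp
  also have "\<dots> = V * (?D\<^sup>T * ?D) * V\<^sup>T"
    using S(5) D by (intro mult_mat_regroup[of _ n n _ m _ n _ n]) auto
  finally show ?thesis by (simp add: rect_diag_gram)
qed

lemma proots_linear_factors:
  fixes xs :: "'a :: idom list"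
  shows "proots (\<Prod>a\<leftarrow>xs. [:- a, 1:]) = mset xs"
proof (induction xs)
  case (Cons a xs)
  have "(\<Prod>a\<leftarrow>xs. [:- a, 1:]) \<noteq> 0" by (auto simp: prod_list_zero_iff)
  then have "proots ([:- a, 1:] * (\<Prod>a\<leftarrow>xs. [:- a, 1:])) = proots [:- a, 1:] + mset xs"
    by (subst proots_mult) (auto simp: Cons.IH)
  then show ?case by simp
qed simp

text \<open>By \<open>svd_gram\<close>, \<open>A\<^sup>T * A\<close> is similar to the diagonal matrix of the squared singular values,
  so its characteristic polynomial determines them as a multiset; their order and their signs
  are prescribed.\<close>

lemma singular_values_unique:
  assumes "is_svd m n A U \<sigma> V" "is_svd m n A U' \<sigma>' V'" "i < min m n"
  shows "\<sigma> i = \<sigma>' i"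
proof -
  have spectrum: "proots (char_poly (A\<^sup>T * A)) = mset (map (\<lambda>i. (zero_pad (min m n) \<sigma> i)\<^sup>2) [0..<n])"
    if "is_svd m n A U \<sigma> V" for U \<sigma> V
  proof -
    note S = is_svdD[OF that]
    define f where "f = (\<lambda>i. (zero_pad (min m n) \<sigma> i)\<^sup>2)"
    have "similar_mat (A\<^sup>T * A) (mat_diag n f)"
      by (rule similar_matI[of _ _ V "V\<^sup>T" n])
         (use S(1,5) is_orthogonalD[OF S(3)] svd_gram[OF that] in \<open>auto simp: f_def\<close>)
    then have "char_poly (A\<^sup>T * A) = char_poly (mat_diag n f)" by (rule char_poly_similar)
    also have "\<dots> = (\<Prod>a\<leftarrow>diag_mat (mat_diag n f). [:- a, 1:])"
      by (rule char_poly_upper_triangular[of _ n]) (auto simp: mat_diag_def)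
    also have "diag_mat (mat_diag n f) = map f [0..<n]"
      by (auto simp: diag_mat_def mat_diag_def)
    finally show ?thesis by (simp only: proots_linear_factors f_def)
  qed
  have desc: "sorted (rev (map (\<lambda>i. (zero_pad (min m n) \<sigma> i)\<^sup>2) [0..<n]))"
    if "is_svd m n A U \<sigma> V" for U \<sigma> V
    using is_svdD(6,7)[OF that]
    unfolding sorted_rev_iff_nth_mono by (auto simp: zero_pad_def intro!: power_mono)
  have "rev (map (\<lambda>i. (zero_pad (min m n) \<sigma> i)\<^sup>2) [0..<n])
      = rev (map (\<lambda>i. (zero_pad (min m n) \<sigma>' i)\<^sup>2) [0..<n])"
    using spectrum[OF assms(1)] spectrum[OF assms(2)] desc[OF assms(1)] desc[OF assms(2)]
    by (metis mset_rev properties_for_sort)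
  then have "(zero_pad (min m n) \<sigma> i)\<^sup>2 = (zero_pad (min m n) \<sigma>' i)\<^sup>2" using assms(3) by simp
  then show ?thesis
    using assms(3) is_svdD(6)[OF assms(1,3)] is_svdD(6)[OF assms(2,3)] by (simp add: zero_pad_def)
qed

text \<open>An invertible right factor does not change the column space, so that of \<open>A\<close> is the one of
  \<open>U * rect_diag m n \<sigma>\<close>. It is spanned by the columns of \<open>U\<close> that belong to nonzero singular values,
  and these are linearly independent.\<close>

lemma mat_rank_svd:
  assumes "is_svd m n A U \<sigma> V"
  shows "mat_rank A = card {i. i < min m n \<and> \<sigma> i \<noteq> 0}"
proof -
  interpret vec_space "TYPE(real)" m .
  note S = is_svdD[OF assms]
  note U = is_orthogonalD[OF S(2)] and V = is_orthogonalD[OF S(3)]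
  let ?I = "{i. i < min m n \<and> \<sigma> i \<noteq> 0}"
  define B where "B = U * rect_diag m n \<sigma>"
  have B: "B \<in> carrier_mat m n" using U(1) by (simp add: B_def)
  have AB: "A = B * V\<^sup>T" using S(8) by (simp add: B_def)
  have BA: "B = A * V" using AB orthogonal_cancel_right(2)[OF S(3) B] by simp
  have "col_space A = col_space B"
  proof -
    have 1: "A *\<^sub>v x = B *\<^sub>v (V\<^sup>T *\<^sub>v x)" if "x \<in> carrier_vec n" for x
      unfolding AB using that B V(1) by (intro assoc_mult_mat_vec) auto
    have 2: "B *\<^sub>v x = A *\<^sub>v (V *\<^sub>v x)" if "x \<in> carrier_vec n" for x
      unfolding BA using that S(1) V(1) by (intro assoc_mult_mat_vec) auto
    have "(\<exists>x\<in>carrier_vec n. A *\<^sub>v x = y) \<longleftrightarrow> (\<exists>x\<in>carrier_vec n. B *\<^sub>v x = y)" for y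
      using 1 2 V(1) by (metis mult_mat_vec_carrier transpose_carrier_mat)
    moreover have "dim_row A = m" "dim_col A = n" "dim_row B = m" "dim_col B = n"
      using S(1) B by auto
    ultimately show ?thesis by (simp only: col_space_eq[OF S(1)] col_space_eq[OF B])
  qed
  have col_B: "col B j = (if j < m then \<sigma> j \<cdot>\<^sub>v col U j else 0\<^sub>v m)" if "j < n" for j
  proof (rule eq_vecI)
    fix i assume "i < dim_vec (if j < m then \<sigma> j \<cdot>\<^sub>v col U j else 0\<^sub>v m)"
    then have i: "i < m" using U(1) by (auto split: if_splits)
    have "col B j $ i = (\<Sum>l\<in>{0..<m}. U $$ (i, l) * (if l = j then \<sigma> l else 0))"
      using i that U(1) by (simp add: B_def rect_diag_def scalar_prod_def)
    also have "\<dots> = (if j < m then U $$ (i, j) * \<sigma> j else 0)"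
      by (simp add: if_distrib cong: if_cong)
    finally show "col B j $ i = (if j < m then \<sigma> j \<cdot>\<^sub>v col U j else 0\<^sub>v m) $ i"
      using i U(1) by auto
  qed (use B U(1) in auto)
  have col_U: "col U j \<in> carrier_vec m" for j using U(1) by (metis carrier_matD(1) col_dim)
  have S_carrier: "col U ` ?I \<subseteq> carrier_vec m" using col_U by auto
  have "span (set (cols B)) = span (col U ` ?I)"
  proof
    show "span (set (cols B)) \<subseteq> span (col U ` ?I)"
    proof (rule span_subsetI[OF S_carrier], rule subsetI)
      fix x assume "x \<in> set (cols B)"
      then obtain j where j: "j < n" "x = col B j" using B by (auto simp: cols_def)
      show "x \<in> span (col U ` ?I)"
      proof (cases "j < m \<and> \<sigma> j \<noteq> 0")
        case True
        then have "col U j \<in> span (col U ` ?I)" using j S_carrier by (intro span_mem) auto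
        then show ?thesis using True j S_carrier col_U by (simp add: col_B prod_in_span)
      next
        case False
        then have "x = 0\<^sub>v m" using j col_U[of j] by (auto simp: col_B)
        then show ?thesis by (intro in_spanI[of _ "\<lambda>_. 0" "{}"]) (auto simp: lincomb_def)
      qed
    qed
    have B_carrier: "set (cols B) \<subseteq> carrier_vec m" using B cols_dim by blast
    show "span (col U ` ?I) \<subseteq> span (set (cols B))"
    proof (rule span_subsetI[OF B_carrier], rule subsetI)
      fix x assume "x \<in> col U ` ?I"
      then obtain j where j: "j < m" "j < n" "\<sigma> j \<noteq> 0" "x = col U j" by auto
      have "col B j \<in> set (cols B)" using j B by (auto simp: cols_def)
      then have "col B j \<in> span (set (cols B))" using B_carrier by (intro span_mem) auto
      then have "(1 / \<sigma> j) \<cdot>\<^sub>v col B j \<in> span (set (cols B))"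
        by (rule smult_in_span[OF B_carrier])
      also have "(1 / \<sigma> j) \<cdot>\<^sub>v col B j = x"
        using j by (simp add: col_B smult_smult_assoc)
      finally show "x \<in> span (set (cols B))" .
    qed
  qed
  have "lin_indpt (col U ` ?I)"
  proof -
    have "det U * det U = 1"
      using det_mult[of "U\<^sup>T" m U] det_transpose[OF U(1)] U by simp
    then have "lin_indpt (set (cols U))" using lin_dep_cols_imp_det_0[OF U(1)] by auto
    moreover have "col U ` ?I \<subseteq> set (cols U)" using U(1) by (auto simp: cols_def)
    ultimately show ?thesis by (rule subset_li_is_li)
  qed
  have "inj_on (col U) ?I"
  proof (rule inj_onI)
    fix i j assume ij: "i \<in> ?I" "j \<in> ?I" "col U i = col U j"
    have gram: "col U i \<bullet> col U j = (if i = j then 1 else 0)" if "i < m" "j < m" for i j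
    proof -
      have "(U\<^sup>T * U) $$ (i, j) = col U i \<bullet> col U j" using U(1) that by simp
      with U(2) that show ?thesis by simp
    qed
    show "i = j" using gram[of i i] gram[of i j] ij by (auto split: if_splits)
  qed
  have "vectorspace.dim class_ring (span_vs (col U ` ?I)) = card (col U ` ?I)"
    by (rule dim_span) (use S_carrier \<open>lin_indpt (col U ` ?I)\<close> in \<open>auto simp: maximal_def\<close>)
  also have "\<dots> = card ?I" by (rule card_image) fact
  finally show ?thesis
    using \<open>span (set (cols B)) = _\<close> \<open>col_space A = _\<close> S(1)
    by (simp add: mat_rank_def rank_def col_space_def)
qed

lemma decreasing_support:
  fixes \<sigma> :: "nat \<Rightarrow> real"
  assumes "\<And>i. i < q \<Longrightarrow> 0 \<le> \<sigma> i" "\<And>i j. i \<le> j \<Longrightarrow> j < q \<Longrightarrow> \<sigma> j \<le> \<sigma> i"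
  shows "{i. i < q \<and> \<sigma> i \<noteq> 0} = {..<card {i. i < q \<and> \<sigma> i \<noteq> 0}}" (is "?S = _")
proof (rule subset_antisym; rule subsetI)
  fix i assume i: "i \<in> ?S"
  have "{..i} \<subseteq> ?S"
  proof
    fix j assume "j \<in> {..i}"
    then show "j \<in> ?S" using i assms(1)[of i] assms(2)[of j i] by auto
  qed
  then have "card {..i} \<le> card ?S" by (intro card_mono) auto
  then show "i \<in> {..<card ?S}" by simp
next
  fix i assume i: "i \<in> {..<card ?S}"
  show "i \<in> ?S"
  proof (rule ccontr)
    assume "i \<notin> ?S"
    have "?S \<subseteq> {..<i}"
    proof
      fix j assume j: "j \<in> ?S"
      show "j \<in> {..<i}"
      proof (rule ccontr)
        assume "j \<notin> {..<i}"
        then have "\<sigma> j \<le> \<sigma> i" "i < q" using j assms(2)[of i j] by auto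
        then show False using \<open>i \<notin> ?S\<close> j assms(1)[of j] by auto
      qed
    qed
    then have "card ?S \<le> i" using card_mono[of "{..<i}" ?S] by simp
    with i show False by simp
  qed
qed

text \<open>Since singular values decrease, the \<open>mat_rank A\<close> nonzero ones come first. This locates the boundary
  between the diagonal block and the constant block of a GSVD.\<close>

lemma svd_support:
  assumes "is_svd m n A U \<sigma> V"
  shows "{i. i < min m n \<and> \<sigma> i \<noteq> 0} = {..<mat_rank A}"
  unfolding mat_rank_svd[OF assms] by (rule decreasing_support) (rule is_svdD(6,7)[OF assms]; assumption)+

section \<open>The stacked matrix and the block sizes of a GSVD\<close>

lemma append_rows_gram:
  fixes A L :: "'a :: semiring_0 mat"
  assumes A: "A \<in> carrier_mat m n" and L: "L \<in> carrier_mat p n"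
  shows "(A @\<^sub>r L)\<^sup>T * (A @\<^sub>r L) = A\<^sup>T * A + L\<^sup>T * L"
proof (rule eq_matI)
  have K: "A @\<^sub>r L \<in> carrier_mat (m + p) n" using A L by simp
  have col_K: "col (A @\<^sub>r L) j = col A j @\<^sub>v col L j" if "j < n" for j
    using A L that by (intro eq_vecI) (auto simp: append_rows_def)
  fix i j assume "i < dim_row (A\<^sup>T * A + L\<^sup>T * L)" "j < dim_col (A\<^sup>T * A + L\<^sup>T * L)"
  then have ij: "i < n" "j < n" using L by auto
  have cols: "col A l \<in> carrier_vec m" "col L l \<in> carrier_vec p" for l
    using A L by (metis carrier_matD(1) col_dim)+
  have "((A @\<^sub>r L)\<^sup>T * (A @\<^sub>r L)) $$ (i, j) = col (A @\<^sub>r L) i \<bullet> col (A @\<^sub>r L) j"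
    using K ij by simp
  also have "\<dots> = col A i \<bullet> col A j + col L i \<bullet> col L j"
    using ij by (simp add: col_K scalar_prod_append[OF cols cols])
  also have "\<dots> = (A\<^sup>T * A + L\<^sup>T * L) $$ (i, j)" using A L ij by simp
  finally show "((A @\<^sub>r L)\<^sup>T * (A @\<^sub>r L)) $$ (i, j) = (A\<^sup>T * A + L\<^sup>T * L) $$ (i, j)" .
qed (use A L in \<open>auto simp: append_rows_def\<close>)

lemma column_embedding_id: "column_embedding p n (\<lambda>i. i) = rect_diag p n (\<lambda>_. 1)"
  by (simp add: column_embedding_def rect_diag_def)

lemma svd_orthonormal_columns:
  assumes "L \<in> carrier_mat p n" "L\<^sup>T * L = 1\<^sub>m n" "n \<le> p"
  shows "\<exists>U. is_svd p n L U (\<lambda>_. 1) (1\<^sub>m n)"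
proof -
  obtain U where "is_orthogonal p U" "L = U * column_embedding p n (\<lambda>i. i)"
    using orthonormal_columns_completion[OF assms(1,2), of "\<lambda>i. i"] assms(3) by auto
  then have "is_svd p n L U (\<lambda>_. 1) (1\<^sub>m n)"
    using assms(1) is_orthogonal_one by (auto simp: is_svd_def column_embedding_id)
  then show ?thesis ..
qed

text \<open>Stacking adds Gram matrices, so \<open>K = A @\<^sub>r L\<close> satisfies
  \<open>K\<^sup>T * K = A\<^sup>T * A + 1 = V * diag (\<sigma>\<^sup>2 + 1) * V\<^sup>T\<close>. Hence \<open>K\<close> has the right singular vectors of \<open>A\<close> and
  the singular values \<open>sqrt (1 + \<sigma>\<^sup>2)\<close>; dividing the columns of \<open>K * V\<close> by these values gives
  orthonormal columns, which are completed to the left factor.\<close>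

lemma svd_append_orthonormal:
  assumes svd: "is_svd m n A U \<sigma> V"
    and L: "L \<in> carrier_mat p n" "L\<^sup>T * L = 1\<^sub>m n" "n \<le> p"
  shows "\<exists>U'. is_svd (m + p) n (A @\<^sub>r L) U' (\<lambda>i. sqrt (1 + (zero_pad (min m n) \<sigma> i)\<^sup>2)) V"
proof -
  note S = is_svdD[OF svd] and V = is_orthogonalD[OF is_svdD(3)[OF svd]]
  define \<tau> where "\<tau> = zero_pad (min m n) \<sigma>"
  define h where "h i = sqrt (1 + (\<tau> i)\<^sup>2)" for i
  have h: "h i > 0" "(h i)\<^sup>2 = (\<tau> i)\<^sup>2 + 1" "h i \<noteq> 0" for i
    using add_pos_nonneg[of 1 "(\<tau> i)\<^sup>2"] by (auto simp: h_def)
  define K where "K = A @\<^sub>r L"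
  have K: "K \<in> carrier_mat (m + p) n" using S(1) L(1) by (simp add: K_def)
  define H G H2 T2 where "H = mat_diag n h" and "G = mat_diag n (\<lambda>i. 1 / h i)"
    and "H2 = mat_diag n (\<lambda>i. (h i)\<^sup>2)" and "T2 = mat_diag n (\<lambda>i. (\<tau> i)\<^sup>2)"
  have D: "H \<in> carrier_mat n n" "G \<in> carrier_mat n n" "H2 \<in> carrier_mat n n" "T2 \<in> carrier_mat n n"
    by (simp_all add: H_def G_def H2_def T2_def)
  have H2: "H2 = T2 + 1\<^sub>m n"
    by (rule eq_matI) (auto simp: H2_def T2_def mat_diag_def h)
  have "K\<^sup>T * K = V * T2 * V\<^sup>T + 1\<^sub>m n"
    using append_rows_gram[OF S(1) L(1)] svd_gram[OF svd] L(2) by (simp add: K_def T2_def \<tau>_def)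
  also have "\<dots> = V * H2 * V\<^sup>T"
    using D V unfolding H2
    by (simp add: mult_add_distrib_mat[of _ n n _ n] add_mult_distrib_mat[of _ n n _ _ n])
  finally have KK: "K\<^sup>T * K = V * H2 * V\<^sup>T" .
  have VG: "V * G \<in> carrier_mat n n" using V D by simp
  have "(K * (V * G))\<^sup>T * (K * (V * G)) = (V * G)\<^sup>T * (V * H2 * V\<^sup>T) * (V * G)"
    unfolding gram_mult[OF K VG] KK ..
  also have "\<dots> = G * (H2 * G)"
  proof -
    have "(V * G)\<^sup>T = G * V\<^sup>T" using V D by (simp add: transpose_mult[of _ n n _ n] G_def)
    then show ?thesis
      using V(1) D by (simp add: assoc_mult_mat[of _ n n _ n _ n] orthogonal_cancel_left[OF S(3), of _ n])
  qed
  also have "\<dots> = 1\<^sub>m n"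
    using h(3) by (simp add: G_def H2_def power2_eq_square)
  finally have "(K * (V * G))\<^sup>T * (K * (V * G)) = 1\<^sub>m n" .
  moreover have "K * (V * G) \<in> carrier_mat (m + p) n" using K VG by simp
  ultimately obtain U' where U': "is_orthogonal (m + p) U'"
      "K * (V * G) = U' * column_embedding (m + p) n (\<lambda>i. i)"
    using orthonormal_columns_completion[of "K * (V * G)" "m + p" n "\<lambda>i. i"] L(3) by auto
  have KV: "K * V \<in> carrier_mat (m + p) n" using K V(1) by simp
  have GH: "G * H = 1\<^sub>m n" using h(3) by (simp add: G_def H_def)
  have "K = K * V * V\<^sup>T" using orthogonal_cancel_right[OF S(3) K] by simp
  also have "K * V = K * V * (G * H)" unfolding GH by (rule right_mult_one_mat[OF KV, symmetric])
  also have "\<dots> = K * (V * G) * H"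
    using K V(1) D by (simp add: assoc_mult_mat[of _ "m + p" n _ n _ n] assoc_mult_mat[of _ n n _ n _ n])
  also have "\<dots> = U' * rect_diag (m + p) n h"
    using is_orthogonalD(1)[OF U'(1)] D rect_diag_mult_mat_diag[of "m + p" n "\<lambda>_. 1" h]
      assoc_mult_mat[of U' "m + p" "m + p" "rect_diag (m + p) n (\<lambda>_. 1)" n H n]
    by (simp add: U'(2) column_embedding_id H_def)
  finally have "K = U' * rect_diag (m + p) n h * V\<^sup>T" .
  moreover have "h j \<le> h i" if "i \<le> j" for i j
  proof -
    have "0 \<le> \<tau> j" "\<tau> j \<le> \<tau> i"
      using that S(6)[of i] S(6)[of j] S(7)[of i j] by (auto simp: \<tau>_def zero_pad_def)
    then show ?thesis using power_mono[of "\<tau> j" "\<tau> i" 2] by (simp add: h_def)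
  qed
  ultimately have "is_svd (m + p) n K U' h V"
    using K U'(1) S(3) h(1) by (auto simp: is_svd_def intro: less_imp_le)
  then show ?thesis unfolding K_def h_def \<tau>_def by blast
qed

text \<open>Both \<open>L\<close> and the stacked matrix have only positive singular values, hence full column rank. So
  the generalized singular values are all finite, and \<open>mat_rank A\<close> of them are positive.\<close>

lemma gsvd_dimensions:
  assumes svd: "is_svd m n A U \<sigma> V"
    and L: "L \<in> carrier_mat p n" "L\<^sup>T * L = 1\<^sub>m n" "n \<le> p"
  shows "gsvd_t A L = n" "gsvd_r A L = 0" "gsvd_s A L = mat_rank A"
proof -
  have "mat_rank L = n"
    using mat_rank_svd svd_orthonormal_columns[OF L] L(3) by fastforce
  moreover have "mat_rank (A @\<^sub>r L) = n"
  proof -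
    have "sqrt (1 + x\<^sup>2) \<noteq> 0" for x :: real
      using add_pos_nonneg[of 1 "x\<^sup>2"] by simp
    then show ?thesis
      using mat_rank_svd svd_append_orthonormal[OF svd L] L(3) by fastforce
  qed
  ultimately show "gsvd_t A L = n" "gsvd_r A L = 0" "gsvd_s A L = mat_rank A"
    by (simp_all add: gsvd_t_def gsvd_r_def gsvd_s_def)
qed

lemma gsvd_Upsilon_eq_rect_diag:
  assumes "k \<le> min m n"
  shows "gsvd_Upsilon m n 0 k \<upsilon> = rect_diag m n (zero_pad k \<upsilon>)"
  by (rule eq_matI)
     (use assms in \<open>auto simp: gsvd_Upsilon_def rect_diag_def mat_diag_def zero_pad_def Let_def\<close>)

text \<open>The \<open>p - n\<close> zero rows of \<open>gsvd_M\<close> are on top, so the diagonal sits in the last \<open>n\<close> rows.\<close>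

lemma gsvd_M_eq_embedded_diag:
  assumes "k \<le> n" "n \<le> p" "\<And>i. k \<le> i \<Longrightarrow> i < n \<Longrightarrow> \<mu> i = 1"
  shows "gsvd_M p n 0 k \<mu> = column_embedding p n (\<lambda>j. p - n + j) * mat_diag n \<mu>"
  unfolding mat_diag_mult_right[OF column_embedding_carrier]
  by (rule eq_matI)
     (use assms in \<open>auto simp: gsvd_M_def column_embedding_def mat_diag_def Let_def\<close>)

section \<open>Every GSVD yields the singular values\<close>

text \<open>Comparing Gram matrices in the equation for \<open>L\<close> gives \<open>1 = (D * X)\<^sup>T * (D * X)\<close> for
  \<open>D = mat_diag n \<mu>\<close>: the factor \<open>X\<close> is an orthogonal matrix scaled by \<open>1 / \<mu>\<close>. Substituting this into
  the equation for \<open>A\<close> moves the scaling to the diagonal and leaves a singular value decomposition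
  with the singular values \<open>\<upsilon> i / \<mu> i\<close>.\<close>

lemma svd_of_gsvd:
  assumes A: "A \<in> carrier_mat m n" and L: "L \<in> carrier_mat p n" "L\<^sup>T * L = 1\<^sub>m n"
    and orth: "is_orthogonal m U" "is_orthogonal p V" "is_orthogonal n Q"
    and X: "X \<in> carrier_mat n n"
    and E: "E \<in> carrier_mat p n" "E\<^sup>T * E = 1\<^sub>m n"
    and UAQ: "U\<^sup>T * A * Q = rect_diag m n \<upsilon> * X"
    and VLQ: "V\<^sup>T * L * Q = E * mat_diag n \<mu> * X"
    and \<upsilon>: "\<And>i. i < n \<Longrightarrow> 0 \<le> \<upsilon> i" "\<And>i j. i \<le> j \<Longrightarrow> j < n \<Longrightarrow> \<upsilon> j \<le> \<upsilon> i"
    and \<mu>: "\<And>i. i < n \<Longrightarrow> 0 < \<mu> i" "\<And>i j. i \<le> j \<Longrightarrow> j < n \<Longrightarrow> \<mu> i \<le> \<mu> j"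
  shows "\<exists>V'. is_svd m n A U (\<lambda>i. \<upsilon> i / \<mu> i) V'"
proof -
  note U = is_orthogonalD[OF orth(1)] and V = is_orthogonalD[OF orth(2)] and Q = is_orthogonalD[OF orth(3)]
  define D where "D = mat_diag n \<mu>"
  have D: "D \<in> carrier_mat n n" by (simp add: D_def)
  define P where "P = D * X"
  have P: "P \<in> carrier_mat n n" using D X by (simp add: P_def)
  have LQ: "L * Q \<in> carrier_mat p n" using L(1) Q(1) by simp
  have VT: "V\<^sup>T \<in> carrier_mat p p" using V(1) by simp
  have EP: "V\<^sup>T * (L * Q) = E * P"
    using VLQ E(1) D X V(1) L(1) Q(1)
    by (simp add: P_def D_def assoc_mult_mat[of "V\<^sup>T" p p L n Q n] assoc_mult_mat[of E p n "mat_diag n \<mu>" n X n])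
  have "P\<^sup>T * P = (E * P)\<^sup>T * (E * P)"
    using P by (simp add: gram_mult[OF E(1) P] E(2))
  also have "\<dots> = (L * Q)\<^sup>T * (L * Q)"
    unfolding EP[symmetric] gram_mult[OF VT LQ] using V right_mult_one_mat[of "(L * Q)\<^sup>T" n p] LQ by simp
  also have "\<dots> = 1\<^sub>m n"
    unfolding gram_mult[OF L(1) Q(1)] L(2) using Q by simp
  finally have orth_P: "is_orthogonal n P" by (rule is_orthogonalI[OF P])
  define F where "F = mat_diag n (\<lambda>i. 1 / \<mu> i)"
  have F: "F \<in> carrier_mat n n" by (simp add: F_def)
  have "F * D = mat_diag n (\<lambda>i. 1)"
    unfolding F_def D_def mat_diag_diag using \<mu>(1)
    by (auto simp: mat_diag_def less_imp_neq[symmetric] intro!: cong_mat)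
  then have "X = F * P"
    using F D X by (simp add: P_def assoc_mult_mat[of F n n D n X n, symmetric])
  then have "rect_diag m n \<upsilon> * X = rect_diag m n (\<lambda>i. \<upsilon> i / \<mu> i) * P"
    using F P by (simp add: F_def assoc_mult_mat[of "rect_diag m n \<upsilon>" m n _ n P n, symmetric] rect_diag_mult_mat_diag)
  with UAQ have UAQ': "U\<^sup>T * (A * Q) = rect_diag m n (\<lambda>i. \<upsilon> i / \<mu> i) * P"
    using U(1) A Q(1) by (simp add: assoc_mult_mat[of "U\<^sup>T" m m A n Q n])
  have AQ: "A * Q \<in> carrier_mat m n" using A Q(1) by simp
  define R where "R = rect_diag m n (\<lambda>i. \<upsilon> i / \<mu> i)"
  have R: "R \<in> carrier_mat m n" by (simp add: R_def)
  have "A = A * Q * Q\<^sup>T" using orthogonal_cancel_right[OF orth(3) A] by simp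
  also have "A * Q = U * (R * P)"
    using orthogonal_cancel_left(2)[OF orth(1) AQ] UAQ' by (simp add: R_def)
  also have "U * (R * P) * Q\<^sup>T = U * R * (Q * P\<^sup>T)\<^sup>T"
    using U(1) R P Q(1)
    by (simp add: transpose_mult[of Q n n "P\<^sup>T" n] mult_mat_regroup[of U m m R n P n "Q\<^sup>T" n]
        assoc_mult_mat[of U m m R n P n])
  finally have "A = U * R * (Q * P\<^sup>T)\<^sup>T" .
  moreover have "is_orthogonal n (Q * P\<^sup>T)"
    using orth(3) orth_P by (intro is_orthogonal_mult is_orthogonal_transpose)
  moreover have "\<upsilon> j / \<mu> j \<le> \<upsilon> i / \<mu> i" if "i \<le> j" "j < min m n" for i j
    using that \<upsilon>(1)[of i] \<upsilon>(2)[of i j] \<mu>(1)[of i] \<mu>(2)[of i j] by (intro frac_le) auto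
  ultimately have "is_svd m n A U (\<lambda>i. \<upsilon> i / \<mu> i) (Q * P\<^sup>T)"
    using A orth(1) \<upsilon>(1) \<mu>(1) by (auto simp: is_svd_def R_def intro!: divide_nonneg_pos)
  then show ?thesis ..
qed

text \<open>The singular values \<open>\<upsilon> i / \<mu> i\<close> supplied by \<open>svd_of_gsvd\<close> agree with the given ones by uniqueness. For
  \<open>i \<ge> min m n\<close> the index lies in the constant block of the GSVD, where \<open>\<upsilon> i = 0\<close> and \<open>\<mu> i = 1\<close>.\<close>

lemma gen_singular_values_eq_singular_values:
  assumes svd: "is_svd m n A U\<^sub>A \<sigma> V\<^sub>A"
    and L: "L \<in> carrier_mat p n" "L\<^sup>T * L = 1\<^sub>m n" "n \<le> p"
    and gsvd: "is_gsvd m n p A L U V W Q R \<upsilon> \<mu>"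
  defines "\<gamma> \<equiv> gen_singular_values (gsvd_t A L) \<upsilon> \<mu>"
  shows "length \<gamma> = n" "sorted_wrt (\<ge>) \<gamma>"
    "\<And>i. i < min m n \<Longrightarrow> \<gamma> ! i = ereal (\<sigma> i)"
    "\<And>i. min m n \<le> i \<Longrightarrow> i < n \<Longrightarrow> \<gamma> ! i = 0"
proof -
  note dims = gsvd_dimensions[OF svd L]
  define k where "k = mat_rank A"
  have "i < min m n" if "i < k" for i using svd_support[OF svd] that unfolding k_def by blast
  from this[of "min m n"] have k: "k \<le> min m n" by linarith
  have X: "four_block_mat (W\<^sup>T * R) (0\<^sub>m n (n - n)) (0\<^sub>m 0 n) (0\<^sub>m 0 (n - n)) = W\<^sup>T * R"
    if "W\<^sup>T * R \<in> carrier_mat n n"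
    using that by (intro eq_matI) auto
  note G = gsvd[unfolded is_gsvd_def Let_def dims, folded k_def, simplified]
  have WR: "W\<^sup>T * R \<in> carrier_mat n n" using G by (auto simp: is_orthogonal_def)
  have vals: "\<And>i. i < k \<Longrightarrow> 0 < \<upsilon> i \<and> 0 < \<mu> i \<and> \<mu> i < 1"
    "\<And>i j. i \<le> j \<Longrightarrow> j < k \<Longrightarrow> \<upsilon> j \<le> \<upsilon> i \<and> \<mu> i \<le> \<mu> j"
    "\<And>i. k \<le> i \<Longrightarrow> i < n \<Longrightarrow> \<upsilon> i = 0 \<and> \<mu> i = 1"
    using G by auto
  \<comment> \<open>The block matrix reads \<open>\<upsilon>\<close> only below \<open>k\<close>; the rest of its diagonal is zero.\<close>
  define \<upsilon>' where "\<upsilon>' = zero_pad k \<upsilon>"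
  have \<upsilon>': "\<upsilon>' i = \<upsilon> i" if "i < n" for i using vals(3)[of i] that by (auto simp: \<upsilon>'_def zero_pad_def)
  have \<mu>_pos: "0 < \<mu> i" if "i < n" for i
    using vals(1)[of i] vals(3)[of i] that by (cases "i < k") auto
  have \<mu>_mono: "\<mu> i \<le> \<mu> j" if "i \<le> j" "j < n" for i j
    using vals(1)[of i] vals(2)[of i j] vals(3)[of i] vals(3)[of j] that
    by (cases "j < k"; cases "i < k") auto
  have \<upsilon>_nonneg: "0 \<le> \<upsilon> i" if "i < n" for i
    using vals(1)[of i] vals(3)[of i] that by (cases "i < k") auto
  have \<upsilon>_mono: "\<upsilon> j \<le> \<upsilon> i" if "i \<le> j" "j < n" for i j
    using vals(2)[of i j] vals(3)[of j] \<upsilon>_nonneg[of i] that by (cases "j < k") auto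
  have "\<exists>V'. is_svd m n A U (\<lambda>i. \<upsilon>' i / \<mu> i) V'"
  proof (rule svd_of_gsvd)
    show "A \<in> carrier_mat m n" using G by simp
    show "L \<in> carrier_mat p n" "L\<^sup>T * L = 1\<^sub>m n" by fact+
    show "is_orthogonal m U" "is_orthogonal p V" "is_orthogonal n Q" using G by auto
    show "W\<^sup>T * R \<in> carrier_mat n n" by (rule WR)
    show "column_embedding p n (\<lambda>j. p - n + j) \<in> carrier_mat p n" by simp
    show "(column_embedding p n (\<lambda>j. p - n + j))\<^sup>T * column_embedding p n (\<lambda>j. p - n + j) = 1\<^sub>m n"
      using L(3) by (intro column_embedding_gram) (auto simp: inj_on_def)
    show "U\<^sup>T * A * Q = rect_diag m n \<upsilon>' * (W\<^sup>T * R)"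
      using G X[OF WR] gsvd_Upsilon_eq_rect_diag[OF k] by (simp add: \<upsilon>'_def)
    show "V\<^sup>T * L * Q = column_embedding p n (\<lambda>j. p - n + j) * mat_diag n \<mu> * (W\<^sup>T * R)"
      using G X[OF WR] gsvd_M_eq_embedded_diag[of k n p \<mu>] k L(3) vals(3) by auto
  qed (use \<upsilon>' \<mu>_pos \<mu>_mono \<upsilon>_nonneg \<upsilon>_mono in auto)
  then obtain V' where svd': "is_svd m n A U (\<lambda>i. \<upsilon>' i / \<mu> i) V'" ..
  have \<gamma>: "\<gamma> = map (\<lambda>i. ereal (\<upsilon> i / \<mu> i)) [0..<n]"
    using \<mu>_pos by (fastforce simp: \<gamma>_def gen_singular_values_def dims)
  show "length \<gamma> = n" by (simp add: \<gamma>)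
  have "\<upsilon> j / \<mu> j \<le> \<upsilon> i / \<mu> i" if "i \<le> j" "j < n" for i j
    using that \<upsilon>_nonneg[of i] \<upsilon>_mono[of i j] \<mu>_pos[of i] \<mu>_mono[of i j] by (intro frac_le) auto
  then show "sorted_wrt (\<ge>) \<gamma>"
    by (auto simp: \<gamma> sorted_wrt_iff_nth_less)
  show "\<gamma> ! i = ereal (\<sigma> i)" if "i < min m n" for i
    using singular_values_unique[OF svd' svd that] that \<upsilon>'[of i] by (simp add: \<gamma>)
  show "\<gamma> ! i = 0" if "min m n \<le> i" "i < n" for i
    using vals(3)[of i] k that by (simp add: \<gamma>)
qed

section \<open>A GSVD built from a singular value decomposition\<close>

text \<open>The values \<open>\<upsilon> i = \<tau> i / h i\<close> and \<open>\<mu> i = 1 / h i\<close> are the only nonnegative ones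
  with \<open>\<upsilon> i / \<mu> i = \<tau> i\<close>, \<open>\<mu> i \<noteq> 0\<close> and \<open>(\<upsilon> i)\<^sup>2 + (\<mu> i)\<^sup>2 = 1\<close>. With \<open>U\<^sub>A\<close> and \<open>V\<^sub>A\<close> kept as the factors of \<open>A\<close>, the remaining factor
  can be taken diagonal, \<open>R = diag h\<close> and \<open>W = 1\<close>; its diagonal entries are the singular values of the
  stacked matrix. The equation for \<open>L\<close> then says that the last \<open>n\<close> columns of \<open>V\<close> are those of
  \<open>L * V\<^sub>A\<close>, and these are orthonormal.\<close>

lemma gsvd_from_svd:
  assumes svd: "is_svd m n A U\<^sub>A \<sigma> V\<^sub>A"
    and L: "L \<in> carrier_mat p n" "L\<^sup>T * L = 1\<^sub>m n" "n \<le> p"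
  defines "\<tau> \<equiv> zero_pad (min m n) \<sigma>"
  defines "h \<equiv> \<lambda>i. sqrt ((\<tau> i)\<^sup>2 + 1)"
  shows "\<exists>V. is_gsvd m n p A L U\<^sub>A V (1\<^sub>m n) V\<^sub>A (mat_diag n h) (\<lambda>i. \<tau> i / h i) (\<lambda>i. 1 / h i) \<and>
    A = U\<^sub>A * gsvd_Upsilon m n 0 (mat_rank A) (\<lambda>i. \<tau> i / h i) * (mat_diag n h * V\<^sub>A\<^sup>T) \<and>
    L = V * gsvd_M p n 0 (mat_rank A) (\<lambda>i. 1 / h i) * (mat_diag n h * V\<^sub>A\<^sup>T)"
proof -
  note dims = gsvd_dimensions[OF svd L]
  note S = is_svdD[OF svd] and S' = is_svdD[OF is_svd_zero_pad[OF svd], folded \<tau>_def]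
  note UA = is_orthogonalD[OF S(2)] and VA = is_orthogonalD[OF S(3)]
  have h: "h i > 0" "h i \<noteq> 0" "h i \<ge> 1" "(h i)\<^sup>2 = (\<tau> i)\<^sup>2 + 1" for i
    using add_nonneg_pos[of "(\<tau> i)\<^sup>2" 1] by (auto simp: h_def)
  have \<tau>_nonneg: "0 \<le> \<tau> i" for i using S(6)[of i] by (auto simp: \<tau>_def zero_pad_def)
  have \<tau>_mono: "\<tau> j \<le> \<tau> i" if "i \<le> j" for i j
    using that S(6)[of i] S(7)[of i j] by (auto simp: \<tau>_def zero_pad_def)
  have h_mono: "h j \<le> h i" if "i \<le> j" for i j
    using power_mono[OF \<tau>_mono[OF that] \<tau>_nonneg, of 2] by (simp add: h_def)
  define k where "k = mat_rank A"
  have support: "i < min m n \<and> \<sigma> i \<noteq> 0 \<longleftrightarrow> i < k" for i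
    using svd_support[OF svd] unfolding k_def by blast
  then have \<tau>_support: "\<tau> i \<noteq> 0 \<longleftrightarrow> i < k" for i
    unfolding \<tau>_def zero_pad_def by metis
  have k: "k \<le> min m n" using support[of "min m n"] by auto
  define H where "H = mat_diag n h"
  have H: "H \<in> carrier_mat n n" by (simp add: H_def)
  define E where "E = column_embedding p n (\<lambda>j. p - n + j)"
  have E: "E \<in> carrier_mat p n" by (simp add: E_def)
  have trailing: "\<tau> i / h i = 0" "1 / h i = 1" if "k \<le> i" for i
    using \<tau>_support[of i] that by (simp_all add: h_def)
  have Upsilon: "gsvd_Upsilon m n 0 k (\<lambda>i. \<tau> i / h i) = rect_diag m n (\<lambda>i. \<tau> i / h i)"
    unfolding gsvd_Upsilon_eq_rect_diag[OF k]
    by (rule rect_diag_cong) (use \<tau>_support in \<open>auto simp: zero_pad_def\<close>)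
  have UH: "rect_diag m n (\<lambda>i. \<tau> i / h i) * H = rect_diag m n \<tau>"
    unfolding H_def rect_diag_mult_mat_diag using h(2) by simp
  have M: "gsvd_M p n 0 k (\<lambda>i. 1 / h i) = E * mat_diag n (\<lambda>i. 1 / h i)"
    unfolding E_def
  proof (rule gsvd_M_eq_embedded_diag)
    show "k \<le> n" using k by simp
    show "n \<le> p" by (rule L(3))
  qed (rule trailing(2))
  have MH: "E * mat_diag n (\<lambda>i. 1 / h i) * H = E"
  proof -
    have "E * mat_diag n (\<lambda>i. 1 / h i) * H = E * (mat_diag n (\<lambda>i. 1 / h i) * H)"
      by (rule assoc_mult_mat[OF E mat_diag_dim H])
    also have "mat_diag n (\<lambda>i. 1 / h i) * H = 1\<^sub>m n"
      unfolding H_def mat_diag_diag using h(2) by simp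
    finally show ?thesis using E by simp
  qed
  have LV: "L * V\<^sub>A \<in> carrier_mat p n" using L(1) VA(1) by simp
  have "(L * V\<^sub>A)\<^sup>T * (L * V\<^sub>A) = 1\<^sub>m n"
    unfolding gram_mult[OF L(1) VA(1)] L(2) using VA by simp
  moreover have "inj_on (\<lambda>j. p - n + j) {..<n}" "(\<lambda>j. p - n + j) ` {..<n} \<subseteq> {..<p}"
    using L(3) by (auto simp: inj_on_def)
  ultimately obtain V where V: "is_orthogonal p V" "L * V\<^sub>A = V * E"
    using orthonormal_columns_completion[OF LV] unfolding E_def by blast
  note V' = is_orthogonalD[OF V(1)]
  have A_factor: "A = U\<^sub>A * gsvd_Upsilon m n 0 k (\<lambda>i. \<tau> i / h i) * (H * V\<^sub>A\<^sup>T)"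
  proof -
    have C: "rect_diag m n (\<lambda>i. \<tau> i / h i) \<in> carrier_mat m n" by simp
    show ?thesis
      unfolding Upsilon
      using S'(8) mult_mat_regroup[OF UA(1) C H, of "V\<^sub>A\<^sup>T" n] VA(1) by (simp add: UH)
  qed
  have L_factor: "L = V * gsvd_M p n 0 k (\<lambda>i. 1 / h i) * (H * V\<^sub>A\<^sup>T)"
  proof -
    have C: "E * mat_diag n (\<lambda>i. 1 / h i) \<in> carrier_mat p n"
      using mult_carrier_mat[OF E mat_diag_dim] .
    have "V * (E * mat_diag n (\<lambda>i. 1 / h i)) * (H * V\<^sub>A\<^sup>T) = V * E * V\<^sub>A\<^sup>T"
      using mult_mat_regroup[OF V'(1) C H, of "V\<^sub>A\<^sup>T" n] VA(1) by (simp add: MH)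
    then show ?thesis
      unfolding M using orthogonal_cancel_right(1)[OF S(3) L(1)] by (simp add: V(2))
  qed
  have UAV: "U\<^sub>A\<^sup>T * A * V\<^sub>A = gsvd_Upsilon m n 0 k (\<lambda>i. \<tau> i / h i) * H"
  proof -
    have C: "rect_diag m n \<tau> \<in> carrier_mat m n" by simp
    have D: "U\<^sub>A * rect_diag m n \<tau> \<in> carrier_mat m n" using UA(1) by (rule mult_carrier_mat) simp
    have AV: "A * V\<^sub>A = U\<^sub>A * rect_diag m n \<tau>"
      using orthogonal_cancel_right(2)[OF S(3) D] S'(8) by simp
    have "U\<^sub>A\<^sup>T * A * V\<^sub>A = U\<^sub>A\<^sup>T * (A * V\<^sub>A)"
      using UA(1) S(1) VA(1) by (intro assoc_mult_mat) auto
    then show ?thesis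
      unfolding AV Upsilon UH using orthogonal_cancel_left(1)[OF S(2) C] by simp
  qed
  have VLV: "V\<^sup>T * L * V\<^sub>A = gsvd_M p n 0 k (\<lambda>i. 1 / h i) * H"
  proof -
    have "V\<^sup>T * L * V\<^sub>A = V\<^sup>T * (L * V\<^sub>A)"
      using V'(1) L(1) VA(1) by (intro assoc_mult_mat) auto
    then show ?thesis
      unfolding V(2) M MH using orthogonal_cancel_left(1)[OF V(1) E] by simp
  qed
  have "is_svd n n H (1\<^sub>m n) h (1\<^sub>m n)"
  proof -
    have "rect_diag n n h = H" by (rule eq_matI) (auto simp: rect_diag_def H_def mat_diag_def)
    then show ?thesis
      using H h_mono h(1) by (auto simp: is_svd_def is_orthogonal_one intro: less_imp_le)
  qed
  then have sv_H: "has_singular_values H (map h [0..<n])"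
    using H unfolding has_singular_values_def by auto
  have sv_K: "has_singular_values (A @\<^sub>r L) (map h [0..<n])"
  proof -
    have "A @\<^sub>r L \<in> carrier_mat (m + p) n" using S(1) L(1) by simp
    then have "dim_row (A @\<^sub>r L) = m + p" "dim_col (A @\<^sub>r L) = n" "min (m + p) n = n"
      using L(3) by auto
    moreover have "\<exists>U'. is_svd (m + p) n (A @\<^sub>r L) U' h V\<^sub>A"
      using svd_append_orthonormal[OF svd L] by (simp add: h_def \<tau>_def add.commute)
    ultimately show ?thesis unfolding has_singular_values_def by metis
  qed
  have inv_H: "invertible_mat H"
  proof -
    have "inverts_mat H (mat_diag n (\<lambda>i. 1 / h i))" "inverts_mat (mat_diag n (\<lambda>i. 1 / h i)) H"
      using h(2) by (simp_all add: H_def inverts_mat_def carrier_matD[OF mat_diag_dim])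
    then show ?thesis
      using H unfolding invertible_mat_def by auto
  qed
  have block: "four_block_mat ((1\<^sub>m n)\<^sup>T * H) (0\<^sub>m n (n - n)) (0\<^sub>m 0 n) (0\<^sub>m 0 (n - n)) = H"
    using H by (intro eq_matI) auto
  have ratio: "0 < \<tau> i / h i \<and> \<tau> i / h i < 1 \<and> 0 < 1 / h i \<and> 1 / h i < 1"
    "(\<tau> i / h i)\<^sup>2 + (1 / h i)\<^sup>2 = 1" if "i < k" for i
  proof -
    have pos: "0 < \<tau> i" using \<tau>_support[of i] \<tau>_nonneg[of i] that by auto
    have "\<tau> i < h i" unfolding h_def using pos by (intro real_less_rsqrt) auto
    moreover have "1 < h i" unfolding h_def using pos by simp
    ultimately show "0 < \<tau> i / h i \<and> \<tau> i / h i < 1 \<and> 0 < 1 / h i \<and> 1 / h i < 1"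
      using pos h(1)[of i] by simp
    have "(\<tau> i / h i)\<^sup>2 + (1 / h i)\<^sup>2 = ((\<tau> i)\<^sup>2 + 1) / (h i)\<^sup>2"
      by (simp add: power_divide add_divide_distrib)
    also have "\<dots> = 1" unfolding h(4)[symmetric] using h(2)[of i] by simp
    finally show "(\<tau> i / h i)\<^sup>2 + (1 / h i)\<^sup>2 = 1" .
  qed
  have ratio_mono: "\<tau> j / h j \<le> \<tau> i / h i" if "i \<le> j" for i j
  proof -
    \<comment> \<open>After squaring, the mixed terms \<open>(\<tau> i)\<^sup>2 * (\<tau> j)\<^sup>2\<close> cancel.\<close>
    have "\<tau> j * h i \<le> \<tau> i * h j"
    proof (rule power2_le_imp_le)
      have "(\<tau> j)\<^sup>2 \<le> (\<tau> i)\<^sup>2" using \<tau>_mono[OF that] \<tau>_nonneg[of j] by (rule power_mono)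
      then show "(\<tau> j * h i)\<^sup>2 \<le> (\<tau> i * h j)\<^sup>2"
        by (simp add: power_mult_distrib h(4) algebra_simps)
      show "0 \<le> \<tau> i * h j" using \<tau>_nonneg[of i] h(1)[of j] by simp
    qed
    then show ?thesis using h(1)[of i] h(1)[of j] by (simp add: divide_simps mult.commute)
  qed
  have "is_gsvd m n p A L U\<^sub>A V (1\<^sub>m n) V\<^sub>A H (\<lambda>i. \<tau> i / h i) (\<lambda>i. 1 / h i)"
    unfolding is_gsvd_def Let_def dims k_def[symmetric] block
  proof (intro conjI)
    show "\<exists>xs ys. has_singular_values H xs \<and> has_singular_values (A @\<^sub>r L) ys \<and> xs = filter (\<lambda>x. x \<noteq> 0) ys"
      using sv_H sv_K h(2) by (intro exI[of _ "map h [0..<n]"]) (auto simp: filter_id_conv)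
    show "\<forall>i. 0 \<le> i \<and> i < 0 + k \<longrightarrow> 0 < \<tau> i / h i \<and> \<tau> i / h i < 1 \<and> 0 < 1 / h i \<and> 1 / h i < 1 \<and>
        (\<tau> i / h i)\<^sup>2 + (1 / h i)\<^sup>2 = 1"
    proof (intro allI impI)
      fix i assume "0 \<le> i \<and> i < 0 + k"
      then have "i < k" by simp
      from ratio(1)[OF this] ratio(2)[OF this]
      show "0 < \<tau> i / h i \<and> \<tau> i / h i < 1 \<and> 0 < 1 / h i \<and> 1 / h i < 1 \<and>
        (\<tau> i / h i)\<^sup>2 + (1 / h i)\<^sup>2 = 1" by blast
    qed
    show "\<forall>i j. 0 \<le> i \<and> i \<le> j \<and> j < 0 + k \<longrightarrow> \<tau> j / h j \<le> \<tau> i / h i \<and> 1 / h i \<le> 1 / h j"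
    proof (intro allI impI conjI)
      fix i j assume "0 \<le> i \<and> i \<le> j \<and> j < 0 + k"
      then have ij: "i \<le> j" by simp
      show "\<tau> j / h j \<le> \<tau> i / h i" by (rule ratio_mono[OF ij])
      show "1 / h i \<le> 1 / h j" using h_mono[OF ij] h(1)[of i] h(1)[of j] by (intro divide_left_mono) auto
    qed
    show "\<forall>i. 0 + k \<le> i \<and> i < n \<longrightarrow> \<tau> i / h i = 0 \<and> 1 / h i = 1"
      using trailing by auto
  qed (use S(1,2,3) L(1) V(1) H inv_H UAV VLV is_orthogonal_one in auto)
  then show ?thesis using A_factor L_factor unfolding H_def k_def by blast
qed

section \<open>Generalized singular values for a column-orthogonal second matrix\<close>

theorem lemma3p2:
  fixes A L U\<^sub>A V\<^sub>A :: "real mat" and \<sigma> :: "nat \<Rightarrow> real" and m n p k mt :: nat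
  assumes "A \<in> carrier_mat m n"
    and "L \<in> carrier_mat p n" and "n \<le> p" and "L\<^sup>T * L = 1\<^sub>m n"
    and "k = mat_rank A" and "mt = min m n"
    and "is_svd m n A U\<^sub>A \<sigma> V\<^sub>A"
  shows "(\<forall>U V W Q R \<upsilon> \<mu>. is_gsvd m n p A L U V W Q R \<upsilon> \<mu> \<longrightarrow>
            (let \<gamma> = gen_singular_values (gsvd_t A L) \<upsilon> \<mu>
             in length \<gamma> = n \<and> sorted_wrt (\<ge>) \<gamma> \<and>
                (\<forall>i < mt. \<gamma> ! i = ereal (\<sigma> i)) \<and>
                (\<forall>i. mt \<le> i \<and> i < n \<longrightarrow> \<gamma> ! i = 0)))
       \<and> (\<exists>U V W Q R \<upsilon> \<mu> Y Yi.
            is_gsvd m n p A L U V W Q R \<upsilon> \<mu> \<and>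
            is_gsvd_Y n (gsvd_t A L) W Q R Y Yi \<and>
            A = U * gsvd_Upsilon m (gsvd_t A L) (gsvd_r A L) (gsvd_s A L) \<upsilon> * Yi \<and>
            L = V * gsvd_M p (gsvd_t A L) (gsvd_r A L) (gsvd_s A L) \<mu> * Yi \<and>
            Y = V\<^sub>A * mat_diag n (\<lambda>i. if i < k then 1 / sqrt ((\<sigma> i)\<^sup>2 + 1) else 1))"
proof (rule conjI)
  note svd = assms(7) and L = assms(2,4,3)
  show "\<forall>U V W Q R \<upsilon> \<mu>. is_gsvd m n p A L U V W Q R \<upsilon> \<mu> \<longrightarrow>
            (let \<gamma> = gen_singular_values (gsvd_t A L) \<upsilon> \<mu>
             in length \<gamma> = n \<and> sorted_wrt (\<ge>) \<gamma> \<and>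
                (\<forall>i < mt. \<gamma> ! i = ereal (\<sigma> i)) \<and>
                (\<forall>i. mt \<le> i \<and> i < n \<longrightarrow> \<gamma> ! i = 0))"
    unfolding Let_def assms(6)
  proof (intro allI impI)
    fix U V W Q R \<upsilon> \<mu> assume "is_gsvd m n p A L U V W Q R \<upsilon> \<mu>"
    from gen_singular_values_eq_singular_values[OF svd L this]
    show "length (gen_singular_values (gsvd_t A L) \<upsilon> \<mu>) = n \<and>
        sorted_wrt (\<ge>) (gen_singular_values (gsvd_t A L) \<upsilon> \<mu>) \<and>
        (\<forall>i < min m n. gen_singular_values (gsvd_t A L) \<upsilon> \<mu> ! i = ereal (\<sigma> i)) \<and>
        (\<forall>i. min m n \<le> i \<and> i < n \<longrightarrow> gen_singular_values (gsvd_t A L) \<upsilon> \<mu> ! i = 0)"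
      by blast
  qed
  note S = is_svdD[OF svd] and dims = gsvd_dimensions[OF svd L]
  define \<tau> where "\<tau> = zero_pad (min m n) \<sigma>"
  define h where "h i = sqrt ((\<tau> i)\<^sup>2 + 1)" for i
  have h: "h i \<noteq> 0" for i using add_nonneg_pos[of "(\<tau> i)\<^sup>2" 1] by (auto simp: h_def)
  obtain V where V: "is_gsvd m n p A L U\<^sub>A V (1\<^sub>m n) V\<^sub>A (mat_diag n h) (\<lambda>i. \<tau> i / h i) (\<lambda>i. 1 / h i)"
    "A = U\<^sub>A * gsvd_Upsilon m n 0 (mat_rank A) (\<lambda>i. \<tau> i / h i) * (mat_diag n h * V\<^sub>A\<^sup>T)"
    "L = V * gsvd_M p n 0 (mat_rank A) (\<lambda>i. 1 / h i) * (mat_diag n h * V\<^sub>A\<^sup>T)"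
    using gsvd_from_svd[OF svd L] unfolding h_def \<tau>_def by blast
  \<comment> \<open>From the rank of \<open>A\<close> on, \<open>\<tau> i = 0\<close> and thus \<open>h i = 1\<close>: these are the trailing ones of \<open>G\<close>.\<close>
  define G where "G = mat_diag n (\<lambda>i. if i < k then 1 / sqrt ((\<sigma> i)\<^sup>2 + 1) else 1)"
  have G_eq: "G = mat_diag n (\<lambda>i. 1 / h i)"
  proof -
    have "(if i < k then 1 / sqrt ((\<sigma> i)\<^sup>2 + 1) else 1) = 1 / h i" for i
    proof -
      have "i < min m n \<and> \<sigma> i \<noteq> 0 \<longleftrightarrow> i < k"
        using svd_support[OF svd] assms(5) by blast
      then show ?thesis by (auto simp: h_def \<tau>_def zero_pad_def)
    qed
    then show ?thesis by (simp add: G_def)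
  qed
  define H where "H = mat_diag n h"
  have carriers: "G \<in> carrier_mat n n" "H \<in> carrier_mat n n" "V\<^sub>A \<in> carrier_mat n n"
    using S(5) by (simp_all add: G_def H_def)
  have GH: "G * H = 1\<^sub>m n" "H * G = 1\<^sub>m n" using h by (simp_all add: G_eq H_def)
  have "is_gsvd_Y n n (1\<^sub>m n) V\<^sub>A H (V\<^sub>A * G) (H * V\<^sub>A\<^sup>T)"
  proof -
    have "V\<^sub>A * G * (H * V\<^sub>A\<^sup>T) = 1\<^sub>m n"
      using carriers is_orthogonalD(3)[OF S(3)] mult_mat_regroup[of "V\<^sub>A" n n G n H n "V\<^sub>A\<^sup>T" n]
      by (simp add: GH)
    moreover have "H * V\<^sub>A\<^sup>T * (V\<^sub>A * G) = 1\<^sub>m n"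
      using carriers is_orthogonalD(2)[OF S(3)] mult_mat_regroup[of H n n "V\<^sub>A\<^sup>T" n "V\<^sub>A" n G n]
      by (simp add: GH)
    moreover have "(gsvd_Z n n (1\<^sub>m n) V\<^sub>A H)\<^sup>T = H * V\<^sub>A\<^sup>T"
    proof -
      have HT: "H\<^sup>T = H" by (simp add: H_def)
      have "(H\<^sup>T * 1\<^sub>m n) @\<^sub>r 0\<^sub>m (n - n) n = H"
        unfolding HT right_mult_one_mat[OF carriers(2)]
        using carriers(2) by (intro eq_matI) (auto simp: append_rows_def)
      then have "gsvd_Z n n (1\<^sub>m n) V\<^sub>A H = V\<^sub>A * H" by (simp only: gsvd_Z_def)
      then show ?thesis
        using transpose_mult[OF carriers(3,2)] by (simp only: HT)
    qed
    ultimately show ?thesis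
      using carriers by (simp add: is_gsvd_Y_def inverts_mat_def)
  qed
  then show "\<exists>U V W Q R \<upsilon> \<mu> Y Yi.
            is_gsvd m n p A L U V W Q R \<upsilon> \<mu> \<and>
            is_gsvd_Y n (gsvd_t A L) W Q R Y Yi \<and>
            A = U * gsvd_Upsilon m (gsvd_t A L) (gsvd_r A L) (gsvd_s A L) \<upsilon> * Yi \<and>
            L = V * gsvd_M p (gsvd_t A L) (gsvd_r A L) (gsvd_s A L) \<mu> * Yi \<and>
            Y = V\<^sub>A * mat_diag n (\<lambda>i. if i < k then 1 / sqrt ((\<sigma> i)\<^sup>2 + 1) else 1)"
    using V unfolding dims G_def[symmetric] H_def[symmetric] by blast
qed

end
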